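(* Let $F>0$ be the forward price and let the underlying $(S_t)_{0\le t\le T}$ be a martingale with $S_0=F$ satisfying $dS_t=\sigma_t\,dW_t$, where $W$ is a Brownian motion and $\sigma_t$ may be stochastic. Let $C(K)$, $K\in\mathbb{R}$, be the undiscounted price of the European call with strike $K$ and maturity $T$. Assume that the call price is twice differentiable in strike and that boundary terms (in integrations by parts in the strike variable over $\mathbb{R}$) vanish, so that $C_{KK}(K)=q(K)$, where $q$ is the risk-neutral density of $S_T$, and $$\mathbb{E}\left[(S_T-F)^2\right]=\int_{\mathbb{R}}(K-F)^2C_{KK}(K)\,dK .$$ Let $\sigma_N(K)>0$ be the Bachelier implied volatility at strike $K$ and set $x(K)=(F-K)/\sigma_N(K)$, which is strictly decreasing in $K$. Assume that $x(\cdot)$ maps the real strike line onto $\mathbb{R}$, and write $\sigma_N(x)$ for the implied volatility expressed in the normalized coordinate, i.e. $\sigma_N(x):=\sigma_N(K)$ for the unique $K$ with $x(K)=x$. Then $$\mathbb{E}\left[(S_T-F)^2\right]=\int_{\mathbb{R}}\sigma_N(x)^2\,\phi(x)\,dx .$$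
   Context: $\phi$ and $\Phi$ are the standard normal density and distribution function; the discount factor is one; subscripts $K$ denote derivatives in the strike; expectations are risk-neutral. $P(K)$ denotes the undiscounted put price. Static no-arbitrage is assumed throughout: $C$ is decreasing and convex in $K$, $P$ is increasing and convex in $K$, put--call parity $C(K)-P(K)=F-K$ holds, and $\lim_{K\to-\infty}\{C(K)-(F-K)\}=0$, $\lim_{K\to\infty}C(K)=0$. The Bachelier implied volatility $\sigma_N(K)$ is the number $\sigma>0$ such that, with $x=(F-K)/\sigma$, $C(K)=\sigma\{\phi(x)+x\Phi(x)\}$ (equivalently $P(K)=\sigma\{\phi(x)-x\Phi(-x)\}$). *)

theory Defs
  imports "HOL-Probability.Probability"
begin

section \<open>Continuous martingales driven by a Brownian motion\<close>

text \<open>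
  Processes are indexed by real times, but only times in \<open>{0..T}\<close> matter; a filtration on
  \<open>{0..T}\<close> is regarded as one on the whole line by extending it constantly on both sides.
\<close>

definition filtered_space :: "'a measure \<Rightarrow> (real \<Rightarrow> 'a measure) \<Rightarrow> bool" where
  "filtered_space M \<F> \<longleftrightarrow>
     prob_space M \<and> filtration (space M) \<F> \<and> (\<forall>t. subalgebra M (\<F> t))"

definition adapted :: "(real \<Rightarrow> 'a measure) \<Rightarrow> real \<Rightarrow> (real \<Rightarrow> 'a \<Rightarrow> real) \<Rightarrow> bool" where
  "adapted \<F> T X \<longleftrightarrow> (\<forall>t\<in>{0..T}. X t \<in> borel_measurable (\<F> t))"

definition continuous_paths :: "'a measure \<Rightarrow> real \<Rightarrow> (real \<Rightarrow> 'a \<Rightarrow> real) \<Rightarrow> bool" where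
  "continuous_paths M T X \<longleftrightarrow> (AE \<omega> in M. continuous_on {0..T} (\<lambda>t. X t \<omega>))"

definition martingale ::
  "'a measure \<Rightarrow> (real \<Rightarrow> 'a measure) \<Rightarrow> real \<Rightarrow> (real \<Rightarrow> 'a \<Rightarrow> real) \<Rightarrow> bool" where
  "martingale M \<F> T X \<longleftrightarrow>
     adapted \<F> T X \<and> (\<forall>t\<in>{0..T}. integrable M (X t)) \<and>
     (\<forall>s t. 0 \<le> s \<and> s \<le> t \<and> t \<le> T \<longrightarrow> (AE \<omega> in M. real_cond_exp M (\<F> s) (X t) \<omega> = X s \<omega>))"

definition brownian_motion ::
  "'a measure \<Rightarrow> (real \<Rightarrow> 'a measure) \<Rightarrow> real \<Rightarrow> (real \<Rightarrow> 'a \<Rightarrow> real) \<Rightarrow> bool" where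
  "brownian_motion M \<F> T W \<longleftrightarrow>
     adapted \<F> T W \<and> continuous_paths M T W \<and> (AE \<omega> in M. W 0 \<omega> = 0) \<and>
     (\<forall>s t. 0 \<le> s \<and> s < t \<and> t \<le> T \<longrightarrow>
        distributed M lborel (\<lambda>\<omega>. W t \<omega> - W s \<omega>) (normal_density 0 (sqrt (t - s))) \<and>
        prob_space.indep_set M (sets (\<F> s))
          {(\<lambda>\<omega>. W t \<omega> - W s \<omega>) -` A \<inter> space M | A. A \<in> sets borel})"

definition progressive :: "(real \<Rightarrow> 'a measure) \<Rightarrow> real \<Rightarrow> (real \<Rightarrow> 'a \<Rightarrow> real) \<Rightarrow> bool" where
  "progressive \<F> T H \<longleftrightarrow>
     (\<forall>t\<in>{0..T}. (\<lambda>(s, \<omega>). H s \<omega>) \<in>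
        borel_measurable (restrict_space borel {0..t} \<Otimes>\<^sub>M \<F> t))"

text \<open>
  A simple integrand is given by a number of steps \<open>n\<close>, a partition \<open>\<tau>\<close> of \<open>{0..T}\<close> and
  bounded step heights \<open>\<xi> i\<close> known at the left end of the \<open>i\<close>-th step.
\<close>

definition simple_integrand ::
  "'a measure \<Rightarrow> (real \<Rightarrow> 'a measure) \<Rightarrow> real \<Rightarrow> nat \<Rightarrow> (nat \<Rightarrow> real) \<Rightarrow> (nat \<Rightarrow> 'a \<Rightarrow> real) \<Rightarrow> bool" where
  "simple_integrand M \<F> T n \<tau> \<xi> \<longleftrightarrow>
     \<tau> 0 = 0 \<and> \<tau> n = T \<and>
     (\<forall>i<n. \<tau> i < \<tau> (Suc i) \<and> \<xi> i \<in> borel_measurable (\<F> (\<tau> i)) \<and>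
        (\<exists>B. \<forall>\<omega>\<in>space M. \<bar>\<xi> i \<omega>\<bar> \<le> B))"

definition simple_process ::
  "nat \<Rightarrow> (nat \<Rightarrow> real) \<Rightarrow> (nat \<Rightarrow> 'a \<Rightarrow> real) \<Rightarrow> real \<Rightarrow> 'a \<Rightarrow> real" where
  "simple_process n \<tau> \<xi> t \<omega> = (\<Sum>i<n. \<xi> i \<omega> * indicator {\<tau> i<..\<tau> (Suc i)} t)"

definition simple_integral ::
  "(real \<Rightarrow> 'a \<Rightarrow> real) \<Rightarrow> nat \<Rightarrow> (nat \<Rightarrow> real) \<Rightarrow> (nat \<Rightarrow> 'a \<Rightarrow> real) \<Rightarrow> real \<Rightarrow> 'a \<Rightarrow> real" where
  "simple_integral W n \<tau> \<xi> t \<omega> =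
     (\<Sum>i<n. \<xi> i \<omega> * (W (min t (\<tau> (Suc i))) \<omega> - W (min t (\<tau> i)) \<omega>))"

text \<open>
  \<open>X\<close> is the Ito integral of \<open>H\<close> against \<open>W\<close>: \<open>H\<close> is progressively measurable with
  \<open>\<integral>\<^sub>0\<^sup>T H\<^sub>s\<^sup>2 ds < \<infinity>\<close> almost surely, \<open>X\<close> is continuous, and there are simple integrands
  \<open>H\<^sup>m\<close> with \<open>\<integral>\<^sub>0\<^sup>T (H\<^sup>m\<^sub>s - H\<^sub>s)\<^sup>2 ds \<rightarrow> 0\<close> in probability whose elementary integrals up to \<open>t\<close>
  converge to \<open>X\<^sub>t\<close> in probability, for each \<open>t\<close>. As \<open>X\<close> is continuous, this determines \<open>X\<close> up to
  indistinguishability.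
\<close>

definition ito_integral ::
  "'a measure \<Rightarrow> (real \<Rightarrow> 'a measure) \<Rightarrow> real \<Rightarrow> (real \<Rightarrow> 'a \<Rightarrow> real) \<Rightarrow>
   (real \<Rightarrow> 'a \<Rightarrow> real) \<Rightarrow> (real \<Rightarrow> 'a \<Rightarrow> real) \<Rightarrow> bool" where
  "ito_integral M \<F> T W H X \<longleftrightarrow>
     progressive \<F> T H \<and>
     (AE \<omega> in M. (\<integral>\<^sup>+ s\<in>{0..T}. ennreal ((H s \<omega>)\<^sup>2) \<partial>lborel) < \<infinity>) \<and>
     adapted \<F> T X \<and> continuous_paths M T X \<and>
     (\<exists>n \<tau> \<xi>.
        (\<forall>m. simple_integrand M \<F> T (n m) (\<tau> m) (\<xi> m)) \<and>
        (\<forall>\<epsilon>>0. (\<lambda>m. measure M {\<omega> \<in> space M.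
            (\<integral>\<^sup>+ s\<in>{0..T}. ennreal ((simple_process (n m) (\<tau> m) (\<xi> m) s \<omega> - H s \<omega>)\<^sup>2) \<partial>lborel)
              > ennreal \<epsilon>}) \<longlonglongrightarrow> 0) \<and>
        (\<forall>t\<in>{0..T}. \<forall>\<epsilon>>0. (\<lambda>m. measure M {\<omega> \<in> space M.
            \<bar>simple_integral W (n m) (\<tau> m) (\<xi> m) t \<omega> - X t \<omega>\<bar> > \<epsilon>}) \<longlonglongrightarrow> 0))"

section \<open>Option prices and Bachelier implied volatility\<close>

definition call_price :: "'a measure \<Rightarrow> ('a \<Rightarrow> real) \<Rightarrow> real \<Rightarrow> real" where
  "call_price M X K = (\<integral>\<omega>. max (X \<omega> - K) 0 \<partial>M)"

definition put_price :: "'a measure \<Rightarrow> ('a \<Rightarrow> real) \<Rightarrow> real \<Rightarrow> real" where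
  "put_price M X K = (\<integral>\<omega>. max (K - X \<omega>) 0 \<partial>M)"

definition static_no_arbitrage :: "real \<Rightarrow> (real \<Rightarrow> real) \<Rightarrow> (real \<Rightarrow> real) \<Rightarrow> bool" where
  "static_no_arbitrage F C P \<longleftrightarrow>
     antimono C \<and> convex_on UNIV C \<and> mono P \<and> convex_on UNIV P \<and>
     (\<forall>K. C K - P K = F - K) \<and>
     ((\<lambda>K. C K - (F - K)) \<longlongrightarrow> 0) at_bot \<and> (C \<longlongrightarrow> 0) at_top"

abbreviation std_normal_cdf :: "real \<Rightarrow> real" where
  "std_normal_cdf \<equiv> cdf std_normal_distribution"

definition bachelier_call :: "real \<Rightarrow> real \<Rightarrow> real \<Rightarrow> real" where
  "bachelier_call F K s =
     (let x = (F - K) / s in s * (std_normal_density x + x * std_normal_cdf x))"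

definition bachelier_implied_vol :: "real \<Rightarrow> (real \<Rightarrow> real) \<Rightarrow> (real \<Rightarrow> real) \<Rightarrow> bool" where
  "bachelier_implied_vol F C \<sigma>\<^sub>N \<longleftrightarrow> (\<forall>K. \<sigma>\<^sub>N K > 0 \<and> C K = bachelier_call F K (\<sigma>\<^sub>N K))"

definition normalized_strike :: "real \<Rightarrow> (real \<Rightarrow> real) \<Rightarrow> real \<Rightarrow> real" where
  "normalized_strike F \<sigma>\<^sub>N K = (F - K) / \<sigma>\<^sub>N K"

text \<open>
  Existence and uniqueness of the strike are not built in: existence is surjectivity of
  \<open>normalized_strike F \<sigma>\<^sub>N\<close>, uniqueness its strict monotonicity.
\<close>

definition normalized_vol :: "real \<Rightarrow> (real \<Rightarrow> real) \<Rightarrow> real \<Rightarrow> real" where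
  "normalized_vol F \<sigma>\<^sub>N x = \<sigma>\<^sub>N (THE K. normalized_strike F \<sigma>\<^sub>N K = x)"

end

(*
  Writing X = S T, differentiability of the call price forces C'(K) = - P(X > K), so
  C(K) + (F - K) C'(K) = E[ |X - F| ; min F X <= K < max F X ], which integrates over K to
  E[(X - F)^2] by Tonelli. On the other side, implicit differentiation of
  C = sigma (phi(x) + x Phi(x)) with x = (F - K) / sigma yields
  sigma^2 phi(x) (- x'(K)) = C(K) + (F - K) C'(K), and this is positive, so K -> x(K) is a
  C^1 change of variables of the real line. All integrands are nonnegative, so the identity also
  holds when both sides are infinite.
*)
theory Submission
  imports Defs
begin

section \<open>Calculus: the normal distribution function, implicit functions, substitution on the
  line\<close>

text \<open>Split the distribution function at \<open>a = x - 1\<close>: below \<open>a\<close> it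
  contributes a constant, above it the integral \<open>J\<close> of a continuous function, to which
  the fundamental theorem of calculus applies. As \<open>a < x\<close>, the splitting is valid near
  \<open>x\<close>.\<close>

lemma std_normal_cdf_has_real_derivative:
  "(std_normal_cdf has_real_derivative std_normal_density x) (at x)"
proof -
  interpret N: prob_space std_normal_distribution
    by (rule prob_space_normal_density) simp
  define a where "a = x - 1"
  define J where "J y = integral {a..y} std_normal_density" for y
  have cont: "continuous_on A std_normal_density" for A
    unfolding normal_density_def by (intro continuous_intros) auto
  have cdf_eq: "std_normal_cdf y = measure std_normal_distribution {..<a} + J y" if "a \<le> y" for y
  proof -
    have hi: "(std_normal_density has_integral J y) {a..y}"
      unfolding J_def by (intro integrable_integral integrable_continuous_real cont)
    have "(\<integral>\<^sup>+t. ennreal (indicator {a..y} t * std_normal_density t) \<partial>lborel) = ennreal (J y)"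
    proof (rule nn_integral_has_integral_lborel)
      show "((\<lambda>t. indicator {a..y} t * std_normal_density t) has_integral J y) UNIV"
        using hi by (subst (asm) has_integral_restrict_UNIV[symmetric])
          (simp add: indicator_def of_bool_def if_distrib[where f = "\<lambda>u. u * _"] cong: if_cong)
    qed auto
    moreover have "0 \<le> J y"
      by (rule has_integral_nonneg[OF hi]) auto
    ultimately have "measure std_normal_distribution {a..y} = J y"
      by (simp add: measure_def emeasure_density mult.commute nn_integral_set_ennreal)
    moreover have "{..y} = {..<a} \<union> {a..y}" using that by auto
    moreover have "measure std_normal_distribution ({..<a} \<union> {a..y}) =
      measure std_normal_distribution {..<a} + measure std_normal_distribution {a..y}"
      by (intro N.finite_measure_Union) auto
    ultimately show ?thesis by (simp add: cdf_def)
  qed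
  have "(J has_real_derivative std_normal_density x) (at x within {a..x+1})"
    unfolding J_def by (rule integral_has_real_derivative[OF cont]) (auto simp: a_def)
  then have "(J has_real_derivative std_normal_density x) (at x)"
    by (subst (asm) at_within_interior) (auto simp: a_def)
  then have "((\<lambda>y. measure std_normal_distribution {..<a} + J y) has_real_derivative std_normal_density x) (at x)"
    by (auto intro!: derivative_eq_intros)
  moreover have "eventually (\<lambda>y. std_normal_cdf y = measure std_normal_distribution {..<a} + J y) (nhds x)"
    using eventually_nhds_in_open[of "{a<..}" x]
    by (rule eventually_mono[rotated 2]) (auto intro: cdf_eq, simp add: a_def)
  ultimately show ?thesis
    by (simp only: DERIV_cong_ev[OF refl _ refl])
qed

lemma std_normal_density_has_real_derivative:
  "(std_normal_density has_real_derivative - x * std_normal_density x) (at x)"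
  unfolding normal_density_def
  by (auto intro!: derivative_eq_intros simp: field_simps)

text \<open>Monotonicity of \<open>B a\<close> forces continuity of the solution \<open>s\<close>;
  the mean value theorem in the second argument then gives an explicit formula for the difference
  quotient of \<open>s\<close>.\<close>

lemma implicit_function_has_real_derivative:
  fixes B B' :: "real \<Rightarrow> real \<Rightarrow> real" and s c :: "real \<Rightarrow> real"
  assumes deriv: "\<And>a t. 0 < t \<Longrightarrow> (B a has_real_derivative B' a t) (at t)"
    and pos: "\<And>a t. 0 < t \<Longrightarrow> 0 < B' a t"
    and cont: "\<And>t. 0 < t \<Longrightarrow> isCont (\<lambda>a. B a t) a0"
    and s_pos: "\<And>a. 0 < s a"
    and eq: "\<And>a. c a = B a (s a)"
    and derc: "(c has_real_derivative c') (at a0)"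
    and derB: "((\<lambda>a. B a (s a0)) has_real_derivative d) (at a0)"
    and cont': "isCont (\<lambda>(a, t). B' a t) (a0, s a0)"
  shows "(s has_real_derivative (c' - d) / B' a0 (s a0)) (at a0)"
proof -
  have mono: "B a t < B a u" if "0 < t" "t < u" for a t u
  proof (rule DERIV_pos_imp_increasing[OF that(2)])
    fix v assume "t \<le> v"
    then show "\<exists>y. DERIV (B a) v :> y \<and> 0 < y"
      using deriv[of v a] pos[of v a] that(1) by (intro exI[of _ "B' a v"]) simp
  qed
  have less_iff: "B a t < B a u \<longleftrightarrow> t < u" if "0 < t" "0 < u" for a t u
    using mono[OF that(1), of u a] mono[OF that(2), of t a] by (cases t u rule: linorder_cases) auto
  have c_lim: "(c \<longlongrightarrow> c a0) (at a0)"
    using DERIV_isCont[OF derc] by (simp add: isCont_def)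
  have B_lim: "((\<lambda>a. B a t) \<longlongrightarrow> B a0 t) (at a0)" if "0 < t" for t
    using cont[OF that] by (simp add: isCont_def)
  \<comment> \<open>By strict monotonicity, comparing \<open>s a\<close> with a fixed level amounts
    to comparing \<open>c a\<close> with \<open>B a\<close> at that level, and both of these are
    continuous at \<open>a0\<close>.\<close>
  have s_lim: "(s \<longlongrightarrow> s a0) (at a0)"
  proof (rule order_tendstoI)
    fix l assume l: "l < s a0"
    \<comment> \<open>Raising the level to at least \<open>s a0 / 2\<close> keeps it positive, where
      \<open>B a\<close> is known to be increasing.\<close>
    define m where "m = max l (s a0 / 2)"
    have m: "0 < m" "l \<le> m" "m < s a0" using s_pos[of a0] l by (auto simp: m_def)
    then have "0 < c a0 - B a0 m" using mono[of m "s a0" a0] by (simp add: eq)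
    then have "eventually (\<lambda>a. 0 < c a - B a m) (at a0)"
      by (intro order_tendstoD(1)[OF tendsto_diff[OF c_lim B_lim]] m)
    then show "eventually (\<lambda>a. l < s a) (at a0)"
      by eventually_elim (use m s_pos in \<open>auto simp: eq less_iff intro: le_less_trans\<close>)
  next
    fix u assume u: "s a0 < u"
    have u0: "0 < u" using s_pos[of a0] u by simp
    then have "0 < B a0 u - c a0" using mono[of "s a0" u a0] s_pos[of a0] u by (simp add: eq)
    then have "eventually (\<lambda>a. 0 < B a u - c a) (at a0)"
      by (intro order_tendstoD(1)[OF tendsto_diff[OF B_lim c_lim]] u0)
    then show "eventually (\<lambda>a. s a < u) (at a0)"
      by eventually_elim (use u0 s_pos in \<open>auto simp: eq less_iff\<close>)
  qed
  \<comment> \<open>The bounds are weak so that the case \<open>s a = s a0\<close> is covered and an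
    intermediate point can be chosen for every \<open>a\<close>.\<close>
  have "\<exists>\<xi>. min (s a0) (s a) \<le> \<xi> \<and> \<xi> \<le> max (s a0) (s a) \<and>
      B a (s a) - B a (s a0) = (s a - s a0) * B' a \<xi>" for a
  proof (cases "s a0" "s a" rule: linorder_cases)
    case less
    from MVT2[OF this, of "B a" "B' a"] deriv s_pos[of a0] obtain \<xi> where
      "s a0 < \<xi>" "\<xi> < s a" "B a (s a) - B a (s a0) = (s a - s a0) * B' a \<xi>" by auto
    with less show ?thesis by (intro exI[of _ \<xi>]) auto
  next
    case greater
    from MVT2[OF this, of "B a" "B' a"] deriv s_pos[of a] obtain \<xi> where
      "s a < \<xi>" "\<xi> < s a0" "B a (s a0) - B a (s a) = (s a0 - s a) * B' a \<xi>" by auto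
    with greater show ?thesis by (intro exI[of _ \<xi>]) (auto simp: algebra_simps)
  qed auto
  then obtain \<xi> where \<xi>: "\<And>a. min (s a0) (s a) \<le> \<xi> a" "\<And>a. \<xi> a \<le> max (s a0) (s a)"
    "\<And>a. B a (s a) - B a (s a0) = (s a - s a0) * B' a (\<xi> a)" by metis
  have \<xi>_lim: "(\<xi> \<longlongrightarrow> s a0) (at a0)"
  proof (rule tendsto_sandwich)
    show "((\<lambda>a. min (s a0) (s a)) \<longlongrightarrow> s a0) (at a0)" "((\<lambda>a. max (s a0) (s a)) \<longlongrightarrow> s a0) (at a0)"
      using tendsto_min[OF tendsto_const[of "s a0"] s_lim] tendsto_max[OF tendsto_const[of "s a0"] s_lim]
      by simp_all
  qed (use \<xi> in auto)
  have \<xi>_pos: "0 < \<xi> a" for a using \<xi>(1)[of a] s_pos[of a] s_pos[of a0] by linarith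
  have "((\<lambda>a. B' a (\<xi> a)) \<longlongrightarrow> B' a0 (s a0)) (at a0)"
    using isCont_tendsto_compose[OF cont' tendsto_Pair[OF tendsto_ident_at \<xi>_lim]] by simp
  then have "((\<lambda>a. ((c a - c a0) / (a - a0) - (B a (s a0) - B a0 (s a0)) / (a - a0)) / B' a (\<xi> a))
      \<longlongrightarrow> (c' - d) / B' a0 (s a0)) (at a0)"
    using derc derB pos[OF s_pos, of a0 a0]
    by (intro tendsto_intros) (auto simp: has_field_derivative_iff)
  \<comment> \<open>Split \<open>c a - c a0\<close> at \<open>B a (s a0)\<close>: one piece varies
    only the second argument, the other only the first. At \<open>a = a0\<close> both sides are zero
    by division by zero.\<close>
  moreover have "((c a - c a0) / (a - a0) - (B a (s a0) - B a0 (s a0)) / (a - a0)) / B' a (\<xi> a)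
      = (s a - s a0) / (a - a0)" for a
  proof -
    have "c a - c a0 - (B a (s a0) - B a0 (s a0)) = (s a - s a0) * B' a (\<xi> a)"
      using \<xi>(3)[of a] by (simp add: eq)
    then have "(c a - c a0) / (a - a0) - (B a (s a0) - B a0 (s a0)) / (a - a0)
      = (s a - s a0) * B' a (\<xi> a) / (a - a0)"
      by (simp add: diff_divide_distrib[symmetric])
    then show ?thesis using pos[OF \<xi>_pos, of a a] by simp
  qed
  ultimately show ?thesis by (simp add: has_field_derivative_iff)
qed

text \<open>Substitution on compact intervals passes to the limit by monotone convergence: the
  intervals exhaust the line, and so do their images because \<open>g\<close> is onto.\<close>

lemma nn_integral_substitution_surj:
  fixes g g' :: "real \<Rightarrow> real" and f :: "real \<Rightarrow> ennreal"
  assumes f [measurable]: "f \<in> borel_measurable borel"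
    and deriv: "\<And>x. (g has_real_derivative g' x) (at x)"
    and cont: "continuous_on UNIV g'"
    and nonneg: "\<And>x. 0 \<le> g' x"
    and surj: "surj g"
  shows "(\<integral>\<^sup>+y. f y \<partial>lborel) = (\<integral>\<^sup>+x. f (g x) * g' x \<partial>lborel)"
proof -
  have mono: "g x \<le> g y" if "x \<le> y" for x y
    using that by (rule DERIV_nonneg_imp_nondecreasing) (use deriv nonneg in blast)
  have [measurable]: "g \<in> borel_measurable borel"
    by (rule borel_measurable_mono) (simp add: mono monoI)
  have [measurable]: "g' \<in> borel_measurable borel"
    by (rule borel_measurable_continuous_onI[OF cont])
  \<comment> \<open>The successor makes \<open>- a n < a n\<close> strict already at
    \<open>n = 0\<close>.\<close>
  define a :: "nat \<Rightarrow> real" where "a n = real (Suc n)" for n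
  have a: "- a n < a n" "m \<le> n \<Longrightarrow> a m \<le> a n" for m n by (simp_all add: a_def)
  have a_ex: "\<exists>n. \<bar>x\<bar> \<le> a n" for x
    using real_arch_simple[of "\<bar>x\<bar>"] unfolding a_def by (metis le_SucI of_nat_le_iff order.trans order_refl)
  have exhaust: "(\<integral>\<^sup>+x. h x \<partial>lborel) = (SUP n. \<integral>\<^sup>+x. h x * indicator (A n) x \<partial>lborel)"
    if [measurable]: "h \<in> borel_measurable borel" "\<And>n. A n \<in> sets borel"
      and "incseq A" and ex: "\<And>x. \<exists>n. x \<in> A n" for h :: "real \<Rightarrow> ennreal" and A :: "nat \<Rightarrow> real set"
  proof -
    have "(SUP n. h x * indicator (A n) x) = h x" for x
    proof (rule antisym)
      show "(SUP n. h x * indicator (A n) x) \<le> h x"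
        by (rule SUP_least) (auto split: split_indicator)
      obtain n where "x \<in> A n" using ex by blast
      then show "h x \<le> (SUP n. h x * indicator (A n) x)"
        by (intro SUP_upper2[of n]) auto
    qed
    then have "(\<integral>\<^sup>+x. h x \<partial>lborel) = (\<integral>\<^sup>+x. (SUP n. h x * indicator (A n) x) \<partial>lborel)" by simp
    also have "\<dots> = (SUP n. \<integral>\<^sup>+x. h x * indicator (A n) x \<partial>lborel)"
      using \<open>incseq A\<close>
      by (intro nn_integral_monotone_convergence_SUP)
        (auto simp: incseq_def le_fun_def split: split_indicator)
    finally show ?thesis .
  qed
  have "(\<integral>\<^sup>+y. f y \<partial>lborel) = (SUP n. \<integral>\<^sup>+y. f y * indicator {g (- a n)..g (a n)} y \<partial>lborel)"
  proof (rule exhaust)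
    show "incseq (\<lambda>n. {g (- a n)..g (a n)})"
      unfolding incseq_def using a(2) by (auto intro!: mono)
    fix y obtain x where "y = g x" using surj by blast
    moreover obtain n where "\<bar>x\<bar> \<le> a n" using a_ex by blast
    ultimately show "\<exists>n. y \<in> {g (- a n)..g (a n)}" by (auto intro!: exI[of _ n] mono)
  qed auto
  also have "\<dots> = (SUP n. \<integral>\<^sup>+x. f (g x) * g' x * indicator {- a n..a n} x \<partial>lborel)"
    by (intro SUP_cong refl nn_integral_substitution_aux)
      (use deriv nonneg a cont in \<open>auto intro: continuous_on_subset\<close>)
  also have "\<dots> = (\<integral>\<^sup>+x. f (g x) * g' x \<partial>lborel)"
  proof (rule exhaust[symmetric])
    show "incseq (\<lambda>n. {- a n..a n})" by (auto simp: incseq_def a_def)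
    fix x obtain n where "\<bar>x\<bar> \<le> a n" using a_ex by blast
    then show "\<exists>n. x \<in> {- a n..a n}" by (auto intro!: exI[of _ n])
  qed auto
  finally show ?thesis .
qed

section \<open>The Bachelier formula and its implied volatility\<close>

text \<open>The product rule contributes \<open>x * std_normal_density x\<close>, which cancels
  against the derivative of the density.\<close>

lemma std_bachelier_has_real_derivative:
  "((\<lambda>x. std_normal_density x + x * std_normal_cdf x) has_real_derivative std_normal_cdf x) (at x)"
  by (auto intro!: derivative_eq_intros std_normal_cdf_has_real_derivative
      std_normal_density_has_real_derivative)

lemma std_normal_cdf_strict_mono: "x < y \<Longrightarrow> std_normal_cdf x < std_normal_cdf y"
  by (rule DERIV_pos_imp_increasing)
    (auto intro!: exI std_normal_cdf_has_real_derivative normal_density_pos)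

text \<open>The weak bounds at \<open>x - 1\<close> and \<open>x + 1\<close> become strict at
  \<open>x\<close>.\<close>

lemma std_normal_cdf_bounds: "0 < std_normal_cdf x" "std_normal_cdf x < 1"
proof -
  interpret real_distribution std_normal_distribution
    by (rule real_distribution.intro[OF prob_space_normal_density])
      (auto simp: real_distribution_axioms_def)
  show "0 < std_normal_cdf x"
    using cdf_nonneg[of "x - 1"] std_normal_cdf_strict_mono[of "x - 1" x] by simp
  show "std_normal_cdf x < 1"
    using cdf_bounded_prob[of "x + 1"] std_normal_cdf_strict_mono[of x "x + 1"] by simp
qed

text \<open>This is the Bachelier vega; the distribution function terms cancel. Its positivity makes
  the implicit function theorem applicable to the implied volatility.\<close>

lemma bachelier_call_has_real_derivative_vol:
  assumes "0 < s"
  shows "(bachelier_call F K has_real_derivative std_normal_density ((F - K) / s)) (at s)"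
proof -
  let ?g = "\<lambda>x. std_normal_density x + x * std_normal_cdf x"
  have "((\<lambda>s. (F - K) / s) has_real_derivative - (F - K) / s\<^sup>2) (at s)"
    using assms by (auto intro!: derivative_eq_intros simp: power2_eq_square)
  from DERIV_mult[OF DERIV_ident DERIV_chain'[OF this std_bachelier_has_real_derivative]]
  have "((\<lambda>s. s * ?g ((F - K) / s)) has_real_derivative
      ?g ((F - K) / s) - (F - K) / s * std_normal_cdf ((F - K) / s)) (at s)"
    by (rule DERIV_cong) (use assms in \<open>simp add: field_simps power2_eq_square\<close>)
  then show ?thesis
    by (simp add: bachelier_call_def[abs_def] Let_def)
qed

lemma bachelier_call_has_real_derivative_strike:
  assumes "0 < s"
  shows "((\<lambda>K. bachelier_call F K s) has_real_derivative - std_normal_cdf ((F - K) / s)) (at K)"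
proof -
  have "((\<lambda>K. (F - K) / s) has_real_derivative - 1 / s) (at K)"
    using assms by (auto intro!: derivative_eq_intros)
  from DERIV_cmult[OF DERIV_chain'[OF this std_bachelier_has_real_derivative], of s]
  show ?thesis
    using assms by (simp add: bachelier_call_def Let_def)
qed

text \<open>
  With \<open>x = (F - K) / \<sigma>\<close>, the call and put prices are \<open>\<sigma> g(x)\<close> and \<open>\<sigma> (g(x) - x)\<close> for
  \<open>g(x) = \<phi>(x) + x \<Phi>(x)\<close>. As \<open>x\<close> takes all real values, nonnegative prices give \<open>g \<ge> 0\<close>
  and \<open>g(x) - x \<ge> 0\<close> everywhere, and strict monotonicity improves this to strict inequalities.
\<close>

lemma bachelier_implied_prices_pos:
  assumes iv: "bachelier_implied_vol F C \<sigma>"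
    and onto: "surj (normalized_strike F \<sigma>)"
    and call: "\<And>K. 0 \<le> C K" and put: "\<And>K. F - K \<le> C K"
  shows "0 < C K" "F - K < C K"
proof -
  let ?g = "\<lambda>x. std_normal_density x + x * std_normal_cdf x"
  have pos: "0 < \<sigma> K" and C: "C K = \<sigma> K * ?g (normalized_strike F \<sigma> K)" for K
    using iv by (simp_all add: bachelier_implied_vol_def bachelier_call_def normalized_strike_def Let_def)
  have FK: "F - K = \<sigma> K * normalized_strike F \<sigma> K" for K
    using pos[of K] by (simp add: normalized_strike_def)
  have g: "0 \<le> ?g x" "x \<le> ?g x" for x
  proof -
    obtain K where K: "x = normalized_strike F \<sigma> K" using onto by blast
    show "0 \<le> ?g x" using call[of K] pos[of K] by (simp add: C K zero_le_mult_iff)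
    show "x \<le> ?g x" using put[of K] pos[of K] by (simp add: C K FK del: distrib_left)
  qed
  \<comment> \<open>\<open>?g\<close> has derivative \<open>std_normal_cdf > 0\<close>, while
    \<open>?g x - x\<close> below has derivative \<open>std_normal_cdf x - 1 < 0\<close>. Hence
    strictness comes from comparison with \<open>x - 1\<close> and \<open>x + 1\<close>
    respectively.\<close>
  have "?g (x - 1) < ?g x" for x
    by (rule DERIV_pos_imp_increasing[where f = ?g])
      (auto intro!: exI std_bachelier_has_real_derivative std_normal_cdf_bounds)
  then show "0 < C K" unfolding C using pos[of K] g(1) by (intro mult_pos_pos) (auto intro: le_less_trans)
  have "?g (x + 1) - (x + 1) < ?g x - x" for x
  proof (rule DERIV_neg_imp_decreasing[where f = "\<lambda>x. ?g x - x"])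
    fix y show "\<exists>d. ((\<lambda>x. ?g x - x) has_real_derivative d) (at y) \<and> d < 0"
      using DERIV_diff[OF std_bachelier_has_real_derivative DERIV_ident, of y] std_normal_cdf_bounds(2)[of y]
      by (intro exI[of _ "std_normal_cdf y - 1"]) simp
  qed simp
  then have "x < ?g x" for x using g(2)[of "x + 1"] by (smt (verit))
  then show "F - K < C K" unfolding C FK using pos[of K] by (intro mult_strict_left_mono)
qed

text \<open>
  The hypothesis \<open>D\<close> is strict monotonicity of the normalized strike: by the implicit function
  theorem \<open>- x'(K) = (C K + (F - K) C' K) / (\<sigma>(K)\<^sup>2 \<phi>(x(K)))\<close>.
\<close>

lemma
  assumes iv: "bachelier_implied_vol F C \<sigma>"
    and onto: "surj (normalized_strike F \<sigma>)"
    and deriv: "\<And>K. (C has_real_derivative C' K) (at K)"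
    and cont: "continuous_on UNIV C'"
    and D: "\<And>K. 0 < C K + (F - K) * C' K"
  shows normalized_vol_measurable: "normalized_vol F \<sigma> \<in> borel_measurable borel"
    and nn_integral_normalized_vol:
      "(\<integral>\<^sup>+x. ennreal ((normalized_vol F \<sigma> x)\<^sup>2 * std_normal_density x) \<partial>lborel)
      = (\<integral>\<^sup>+K. ennreal (C K + (F - K) * C' K) \<partial>lborel)"
proof -
  define x where "x = normalized_strike F \<sigma>"
  have pos: "0 < \<sigma> K" and C: "C K = bachelier_call F K (\<sigma> K)" for K
    using iv by (simp_all add: bachelier_implied_vol_def)
  have x: "x K = (F - K) / \<sigma> K" for K by (simp add: x_def normalized_strike_def)
  have phi_pos: "0 < std_normal_density y" for y by (simp add: normal_density_pos)
  have phi_cont: "isCont std_normal_density y" for y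
    using std_normal_density_has_real_derivative by (rule DERIV_isCont)
  define x' where "x' K = - ((C K + (F - K) * C' K) / ((\<sigma> K)\<^sup>2 * std_normal_density (x K)))" for K
  have x'_neg: "x' K < 0" for K using D[of K] pos[of K] phi_pos[of "x K"] by (simp add: x'_def)
  \<comment> \<open>Implicit differentiation: the slope of \<open>C\<close> minus the strike
    derivative of the Bachelier price, divided by vega.\<close>
  have der_\<sigma>: "(\<sigma> has_real_derivative (C' K + std_normal_cdf (x K)) / std_normal_density (x K)) (at K)" for K
  proof -
    have "(\<sigma> has_real_derivative (C' K - - std_normal_cdf ((F - K) / \<sigma> K))
        / std_normal_density ((F - K) / \<sigma> K)) (at K)"
    proof (rule implicit_function_has_real_derivative
        [where B = "bachelier_call F" and B' = "\<lambda>K s. std_normal_density ((F - K) / s)"])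
      show "isCont (\<lambda>K. bachelier_call F K t) K" if "0 < t" for t
        using bachelier_call_has_real_derivative_strike[OF that] by (rule DERIV_isCont)
      show "isCont (\<lambda>(a, t). std_normal_density ((F - a) / t)) (K, \<sigma> K)"
        unfolding case_prod_beta using pos[of K]
        by (intro isCont_o2[OF _ phi_cont] continuous_intros) simp
    qed (rule C deriv pos phi_pos bachelier_call_has_real_derivative_vol
        bachelier_call_has_real_derivative_strike | assumption)+
    then show ?thesis by (simp add: x)
  qed
  have der_x: "(x has_real_derivative x' K) (at K)" for K
  proof -
    have "((\<lambda>K. (F - K) / \<sigma> K) has_real_derivative
        ((0 - 1) * \<sigma> K - (F - K) * ((C' K + std_normal_cdf (x K)) / std_normal_density (x K))) / (\<sigma> K * \<sigma> K)) (at K)"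
      using pos[of K] by (intro DERIV_divide DERIV_diff DERIV_const DERIV_ident der_\<sigma>) simp
    moreover have "(\<lambda>K. (F - K) / \<sigma> K) = x" by (simp add: x fun_eq_iff)
    \<comment> \<open>Substituting the Bachelier formula for \<open>C K\<close> combines
      \<open>\<sigma> K * std_normal_density (x K)\<close> and
      \<open>(F - K) * std_normal_cdf (x K)\<close> into the price itself.\<close>
    moreover have "((0 - 1) * \<sigma> K - (F - K) * ((C' K + std_normal_cdf (x K)) / std_normal_density (x K)))
        / (\<sigma> K * \<sigma> K) = x' K"
    proof -
      have "C K = \<sigma> K * std_normal_density (x K) + (F - K) * std_normal_cdf (x K)"
        using pos[of K] by (simp add: C bachelier_call_def Let_def x distrib_left)
      then show ?thesis
        unfolding x'_def using pos[of K] phi_pos[of "x K"]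
        by (simp add: divide_simps power2_eq_square) (simp add: algebra_simps)
    qed
    ultimately show ?thesis by simp
  qed
  have x_less: "x L < x K" if "K < L" for K L
    using that by (rule DERIV_neg_imp_decreasing) (use der_x x'_neg in blast)
  then have inj: "inj x" by (metis injI less_irrefl linorder_neqE_linordered_idom)
  define k where "k = inv x"
  have x_k: "x (k y) = y" for y using onto by (simp add: k_def x_def surj_f_inv_f)
  \<comment> \<open>Injectivity of \<open>x\<close> makes the description in
    \<open>normalized_vol\<close> pick out \<open>K\<close>.\<close>
  have nv_x: "normalized_vol F \<sigma> (x K) = \<sigma> K" for K
    using inj unfolding normalized_vol_def x_def[symmetric] by (simp add: inj_eq)
  have nv: "normalized_vol F \<sigma> y = \<sigma> (k y)" for y using nv_x[of "k y"] by (simp add: x_k)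
  \<comment> \<open>The inverse of a decreasing map is decreasing, so its negative is monotone and
    therefore Borel.\<close>
  have "mono (\<lambda>y. - k y)"
    using x_less[of "k _" "k _"] by (intro monoI) (metis x_k neg_le_iff_le not_le order.asym order.strict_iff_order)
  then have "(\<lambda>y. - (- k y)) \<in> borel_measurable borel"
    by (intro borel_measurable_uminus borel_measurable_mono)
  then have k_meas: "k \<in> borel_measurable borel" by simp
  have \<sigma>_cont: "continuous_on UNIV \<sigma>" using DERIV_isCont[OF der_\<sigma>] by (auto intro: continuous_at_imp_continuous_on)
  have x_cont: "continuous_on UNIV x" using DERIV_isCont[OF der_x] by (auto intro: continuous_at_imp_continuous_on)
  have C_cont: "continuous_on UNIV C" using DERIV_isCont[OF deriv] by (auto intro: continuous_at_imp_continuous_on)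
  show meas: "normalized_vol F \<sigma> \<in> borel_measurable borel"
    using measurable_compose[OF k_meas borel_measurable_continuous_onI[OF \<sigma>_cont]]
    by (simp add: nv[abs_def])
  have "continuous_on UNIV (\<lambda>K. std_normal_density (x K))"
    by (rule continuous_on_compose2[of UNIV, OF _ x_cont])
      (auto intro: continuous_at_imp_continuous_on phi_cont)
  then have x'_cont: "continuous_on UNIV x'"
    unfolding x'_def by (intro continuous_intros C_cont cont \<sigma>_cont) (use pos phi_pos in \<open>auto simp: less_imp_neq[symmetric]\<close>)
  have [measurable]: "C \<in> borel_measurable borel" "C' \<in> borel_measurable borel"
    by (intro borel_measurable_continuous_onI C_cont cont)+
  let ?f = "\<lambda>y. ennreal ((normalized_vol F \<sigma> y)\<^sup>2 * std_normal_density y)"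
  \<comment> \<open>Since \<open>x\<close> decreases, the strike is reflected to
    \<open>u = - K\<close> so that the substitution rule for nondecreasing maps applies; the
    reflection is undone at the end.\<close>
  have "(\<integral>\<^sup>+y. ?f y \<partial>lborel) = (\<integral>\<^sup>+u. ?f (x (- u)) * ennreal (- x' (- u)) \<partial>lborel)"
  proof (rule nn_integral_substitution_surj)
    show "?f \<in> borel_measurable borel" using meas by measurable
    show "((\<lambda>u. x (- u)) has_real_derivative - x' (- u)) (at u)" for u
      using DERIV_chain'[OF DERIV_minus[OF DERIV_ident] der_x, of u] by simp
    show "continuous_on UNIV (\<lambda>u. - x' (- u))"
      by (intro continuous_on_minus continuous_on_compose2[OF x'_cont]) (auto intro: continuous_intros)
    show "0 \<le> - x' (- u)" for u using x'_neg[of "- u"] by simp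
    show "surj (\<lambda>u. x (- u))" by (rule surjI[of _ "\<lambda>y. - k y"]) (simp add: x_k)
  qed
  also have "\<dots> = (\<integral>\<^sup>+u. ennreal (C (- u) + (F - (- u)) * C' (- u)) \<partial>lborel)"
  proof (rule nn_integral_cong)
    fix u
    have "(\<sigma> (- u))\<^sup>2 * std_normal_density (x (- u)) * (- x' (- u)) = C (- u) + (F - (- u)) * C' (- u)"
      using pos[of "- u"] phi_pos[of "x (- u)"] by (simp add: x'_def)
    then show "?f (x (- u)) * ennreal (- x' (- u)) = ennreal (C (- u) + (F - (- u)) * C' (- u))"
      using x'_neg[of "- u"] phi_pos[of "x (- u)"] by (simp add: nv_x ennreal_mult[symmetric])
  qed
  also have "\<dots> = (\<integral>\<^sup>+K. ennreal (C K + (F - K) * C' K) \<partial>lborel)"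
    using nn_integral_real_affine[of "\<lambda>K. ennreal (C K + (F - K) * C' K)" "-1" 0] by simp
  finally show "(\<integral>\<^sup>+y. ?f y \<partial>lborel) = (\<integral>\<^sup>+K. ennreal (C K + (F - K) * C' K) \<partial>lborel)" .
qed

section \<open>Call prices as expectations, and their integral over strikes\<close>

text \<open>The line of this slope through the price at \<open>K\<close> supports the price curve
  from below, and at a point of differentiability there is only one support line.\<close>

lemma (in prob_space) call_price_has_real_derivative_unique:
  assumes X: "integrable M X" and deriv: "(call_price M X has_real_derivative c) (at K)"
  shows "c = - prob {\<omega>\<in>space M. K < X \<omega>}"
proof -
  define p where "p = prob {\<omega>\<in>space M. K < X \<omega>}"
  have [measurable]: "X \<in> borel_measurable M" using X by simp
  have int: "integrable M (\<lambda>\<omega>. max (X \<omega> - y) 0)" for y using X by simp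
  \<comment> \<open>The inequality holds pointwise for the payoffs: where
    \<open>K < X \<omega>\<close> the lower bound equals \<open>X \<omega> - y\<close>, and
    elsewhere it is zero.\<close>
  have tangent: "call_price M X K - (y - K) * p \<le> call_price M X y" for y
  proof -
    have int': "integrable M (\<lambda>\<omega>. (y - K) * indicator {\<omega>\<in>space M. K < X \<omega>} \<omega>)"
      by (intro integrable_mult_right integrable_real_indicator) (auto simp: emeasure_eq_measure)
    have "call_price M X K - (y - K) * p =
        (\<integral>\<omega>. max (X \<omega> - K) 0 - (y - K) * indicator {\<omega>\<in>space M. K < X \<omega>} \<omega> \<partial>M)"
      using int int' by (simp add: call_price_def p_def)
    also have "\<dots> \<le> call_price M X y"
      unfolding call_price_def using int int'
      by (intro integral_mono) (auto split: split_indicator)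
    finally show ?thesis .
  qed
  \<comment> \<open>By \<open>tangent\<close>, this function has a global minimum at
    \<open>K\<close>, so any radius serves below.\<close>
  have "((\<lambda>y. call_price M X y + (y - K) * p) has_real_derivative c + p) (at K)"
    using deriv by (auto intro!: derivative_eq_intros)
  then have "c + p = 0"
    by (rule DERIV_local_min[where d = 1]) (use tangent in \<open>auto simp: algebra_simps\<close>)
  then show ?thesis by (simp add: p_def)
qed

text \<open>For \<open>K < F\<close>, subtracting the mean-zero variable \<open>X - F\<close> from
  the integrand turns it into a nonnegative one. The left side is
  \<open>C K + (F - K) * C' K\<close> once the slope is known.\<close>

lemma (in prob_space) call_price_tail_eq:
  assumes X: "integrable M X" and mean: "expectation X = F"
  shows "ennreal (call_price M X K - (F - K) * prob {\<omega>\<in>space M. K < X \<omega>}) =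
    (\<integral>\<^sup>+\<omega>. ennreal \<bar>X \<omega> - F\<bar> * indicator {min F (X \<omega>)..<max F (X \<omega>)} K \<partial>M)"
proof -
  have [measurable]: "X \<in> borel_measurable M" using X by simp
  let ?h = "\<lambda>\<omega>. max (X \<omega> - K) 0 - (F - K) * indicator {\<omega>\<in>space M. K < X \<omega>} \<omega>
    - (if K < F then X \<omega> - F else 0)"
  have int: "integrable M (\<lambda>\<omega>. max (X \<omega> - K) 0)"
    "integrable M (\<lambda>\<omega>. (F - K) * indicator {\<omega>\<in>space M. K < X \<omega>} \<omega>)"
    "integrable M (\<lambda>\<omega>. if K < F then X \<omega> - F else 0)"
    using X by (cases "K < F"; auto intro!: integrable_mult_right integrable_real_indicator
        simp: emeasure_eq_measure)+
  \<comment> \<open>The four cases of \<open>K < F\<close> and \<open>K < X \<omega>\<close> agree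
    exactly; the half-open interval matches the strictness of both comparisons.\<close>
  have h: "?h \<omega> = \<bar>X \<omega> - F\<bar> * indicator {min F (X \<omega>)..<max F (X \<omega>)} K" if "\<omega> \<in> space M" for \<omega>
    using that by (auto simp: indicator_def min_def max_def)
  have "call_price M X K - (F - K) * prob {\<omega>\<in>space M. K < X \<omega>} = (\<integral>\<omega>. ?h \<omega> \<partial>M)"
  proof -
    have "expectation (\<lambda>\<omega>. if K < F then X \<omega> - F else 0) = 0"
      using X mean by (cases "K < F") (simp_all add: prob_space)
    moreover have "expectation ?h = expectation (\<lambda>\<omega>. max (X \<omega> - K) 0)
        - expectation (\<lambda>\<omega>. (F - K) * indicator {\<omega>\<in>space M. K < X \<omega>} \<omega>)
        - expectation (\<lambda>\<omega>. if K < F then X \<omega> - F else 0)"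
      by (simp only: Bochner_Integration.integral_diff Bochner_Integration.integrable_diff int)
    ultimately show ?thesis by (simp add: call_price_def)
  qed
  moreover have "(\<integral>\<^sup>+\<omega>. ennreal (?h \<omega>) \<partial>M) = ennreal (\<integral>\<omega>. ?h \<omega> \<partial>M)"
  proof (rule nn_integral_eq_integral)
    show "integrable M ?h" by (intro Bochner_Integration.integrable_diff int)
    show "AE \<omega> in M. 0 \<le> ?h \<omega>" by (rule AE_I2) (simp only: h, simp)
  qed
  moreover have "(\<integral>\<^sup>+\<omega>. ennreal (?h \<omega>) \<partial>M) =
      (\<integral>\<^sup>+\<omega>. ennreal \<bar>X \<omega> - F\<bar> * indicator {min F (X \<omega>)..<max F (X \<omega>)} K \<partial>M)"
    by (rule nn_integral_cong) (simp only: h, simp split: split_indicator)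
  ultimately show ?thesis by simp
qed

text \<open>After Tonelli, each outcome carries weight \<open>\<bar>X \<omega> - F\<bar>\<close> on
  a strike interval of that same length, giving the square.\<close>

lemma (in prob_space) nn_integral_call_price_tail:
  assumes X: "integrable M X" and mean: "expectation X = F"
  shows "(\<integral>\<^sup>+K. ennreal (call_price M X K - (F - K) * prob {\<omega>\<in>space M. K < X \<omega>}) \<partial>lborel) =
    (\<integral>\<^sup>+\<omega>. ennreal ((X \<omega> - F)\<^sup>2) \<partial>M)"
proof -
  have [measurable]: "X \<in> borel_measurable M" using X by simp
  interpret pair_sigma_finite lborel M ..
  let ?h = "\<lambda>K \<omega>. ennreal \<bar>X \<omega> - F\<bar> * indicator {min F (X \<omega>)..<max F (X \<omega>)} K"
  \<comment> \<open>The interval endpoints depend on \<open>\<omega>\<close>; as inequalities in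
    \<open>K\<close> and \<open>\<omega>\<close> they give joint measurability.\<close>
  have h: "(\<lambda>(K, \<omega>). ?h K \<omega>) =
      (\<lambda>(K, \<omega>). if min F (X \<omega>) \<le> K \<and> K < max F (X \<omega>) then ennreal \<bar>X \<omega> - F\<bar> else 0)"
    by (auto simp: fun_eq_iff indicator_def)
  have inner: "(\<integral>\<^sup>+K. ?h K \<omega> \<partial>lborel) = ennreal ((X \<omega> - F)\<^sup>2)" for \<omega>
  proof -
    have "(\<integral>\<^sup>+K. ?h K \<omega> \<partial>lborel) = ennreal \<bar>X \<omega> - F\<bar> * ennreal (max F (X \<omega>) - min F (X \<omega>))"
      by (simp add: nn_integral_cmult)
    also have "max F (X \<omega>) - min F (X \<omega>) = \<bar>X \<omega> - F\<bar>" by auto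
    finally show ?thesis by (simp add: ennreal_mult[symmetric] power2_eq_square)
  qed
  have "(\<integral>\<^sup>+K. \<integral>\<^sup>+\<omega>. ?h K \<omega> \<partial>M \<partial>lborel) = (\<integral>\<^sup>+\<omega>. \<integral>\<^sup>+K. ?h K \<omega> \<partial>lborel \<partial>M)"
    by (rule Fubini'[symmetric]) (unfold h, measurable)
  then show ?thesis by (simp add: inner call_price_tail_eq[OF X mean])
qed

section \<open>Matching the second moment with the integral of the squared normalized
  volatility\<close>

theorem theorem5p1:
  fixes M :: "'a measure" and \<F> :: "real \<Rightarrow> 'a measure"
    and S \<sigma> W :: "real \<Rightarrow> 'a \<Rightarrow> real"
    and F T :: real
    and C P C\<^sub>K C\<^sub>K\<^sub>K q \<sigma>\<^sub>N :: "real \<Rightarrow> real"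
  assumes F_pos: "F > 0" and T_pos: "T > 0"
    and space: "filtered_space M \<F>"
    and bm: "brownian_motion M \<F> T W"
    and mart: "martingale M \<F> T S"
    and start: "AE \<omega> in M. S 0 \<omega> = F"
    and dS: "ito_integral M \<F> T W \<sigma> (\<lambda>t \<omega>. S t \<omega> - F)"
    and call: "C = call_price M (S T)"
    and put: "P = put_price M (S T)"
    and no_arb: "static_no_arbitrage F C P"
    and diff1: "\<And>K. (C has_real_derivative C\<^sub>K K) (at K)"
    and diff2: "\<And>K. (C\<^sub>K has_real_derivative C\<^sub>K\<^sub>K K) (at K)"
    and density: "distributed M lborel (S T) q"
    and C_KK_density: "\<And>K. C\<^sub>K\<^sub>K K = q K"
    and second_moment: "(\<integral>\<^sup>+ \<omega>. ennreal ((S T \<omega> - F)\<^sup>2) \<partial>M)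
          = (\<integral>\<^sup>+ K. ennreal ((K - F)\<^sup>2 * C\<^sub>K\<^sub>K K) \<partial>lborel)"
    and implied_vol: "bachelier_implied_vol F C \<sigma>\<^sub>N"
    and onto: "surj (normalized_strike F \<sigma>\<^sub>N)"
  shows "(\<integral>\<^sup>+ \<omega>. ennreal ((S T \<omega> - F)\<^sup>2) \<partial>M)
           = (\<integral>\<^sup>+ x. ennreal ((normalized_vol F \<sigma>\<^sub>N x)\<^sup>2 * std_normal_density x) \<partial>lborel)
       \<and> (\<integral>\<omega>. (S T \<omega> - F)\<^sup>2 \<partial>M)
           = (\<integral>x. (normalized_vol F \<sigma>\<^sub>N x)\<^sup>2 * std_normal_density x \<partial>lborel)"
proof -
  interpret prob_space M using space by (simp add: filtered_space_def)
  define X where "X = S T"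
  have X: "integrable M X" using mart T_pos by (simp add: martingale_def X_def)
  then have [measurable]: "X \<in> borel_measurable M" by simp
  have C_nonneg: "0 \<le> C K" and P_nonneg: "0 \<le> P K" for K
    by (simp_all add: call put call_price_def put_price_def)
  have parity: "C K - P K = F - K" for K using no_arb by (simp add: static_no_arbitrage_def)
  \<comment> \<open>Put-call parity at strike zero reveals the mean, as positive part minus negative
    part of \<open>X\<close>.\<close>
  have "C 0 - P 0 = (\<integral>\<omega>. max (X \<omega> - 0) 0 - max (0 - X \<omega>) 0 \<partial>M)"
    using X by (subst Bochner_Integration.integral_diff)
      (simp_all add: call put call_price_def put_price_def X_def)
  also have "\<dots> = expectation X" by (rule Bochner_Integration.integral_cong) auto
  finally have mean: "expectation X = F" by (simp add: parity)
  have C\<^sub>K: "C\<^sub>K K = - prob {\<omega>\<in>space M. K < X \<omega>}" for K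
    using call_price_has_real_derivative_unique[OF X] diff1 by (simp add: call X_def)
  \<comment> \<open>Since \<open>C\<^sub>K\<close> lies between -1 and 0, the bound
    \<open>C K > 0\<close> settles \<open>F \<le> K\<close>, and \<open>C K > F - K\<close> settles
    \<open>K < F\<close>. This is what makes the normalized strike strictly decreasing.\<close>
  have D_pos: "0 < C K + (F - K) * C\<^sub>K K" for K
  proof -
    have "F - K \<le> C K" for K using parity[of K] P_nonneg[of K] by simp
    note prices = bachelier_implied_prices_pos[OF implied_vol onto C_nonneg this]
    show ?thesis
    proof (cases "F \<le> K")
      case True
      then have "0 \<le> (F - K) * C\<^sub>K K" by (simp add: C\<^sub>K mult_nonpos_nonneg)
      with prices(1)[of K] show ?thesis by simp
    next
      case False
      then have "0 \<le> (F - K) * (1 + C\<^sub>K K)" by (simp add: C\<^sub>K)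
      with prices(2)[of K] show ?thesis by (simp add: distrib_left)
    qed
  qed
  have "continuous_on UNIV C\<^sub>K"
    using DERIV_isCont[OF diff2] by (auto intro: continuous_at_imp_continuous_on)
  note vol = implied_vol onto diff1 this D_pos
  have "(\<integral>\<^sup>+ \<omega>. ennreal ((X \<omega> - F)\<^sup>2) \<partial>M) = (\<integral>\<^sup>+ K. ennreal (C K + (F - K) * C\<^sub>K K) \<partial>lborel)"
    using nn_integral_call_price_tail[OF X mean] by (simp add: call C\<^sub>K X_def)
  also have "\<dots> = (\<integral>\<^sup>+ x. ennreal ((normalized_vol F \<sigma>\<^sub>N x)\<^sup>2 * std_normal_density x) \<partial>lborel)"
    by (rule nn_integral_normalized_vol[OF vol, symmetric])
  finally have nn: "(\<integral>\<^sup>+ \<omega>. ennreal ((X \<omega> - F)\<^sup>2) \<partial>M)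
      = (\<integral>\<^sup>+ x. ennreal ((normalized_vol F \<sigma>\<^sub>N x)\<^sup>2 * std_normal_density x) \<partial>lborel)" .
  have [measurable]: "normalized_vol F \<sigma>\<^sub>N \<in> borel_measurable borel"
    by (rule normalized_vol_measurable[OF vol])
  \<comment> \<open>Both integrands are nonnegative and measurable, so each real integral is the
    real part of its extended counterpart; in the infinite case both take the default value
    0.\<close>
  have "(\<integral>\<omega>. (X \<omega> - F)\<^sup>2 \<partial>M) = (\<integral>x. (normalized_vol F \<sigma>\<^sub>N x)\<^sup>2 * std_normal_density x \<partial>lborel)"
    by (subst (1 2) integral_eq_nn_integral) (simp_all add: nn)
  with nn show ?thesis by (simp add: X_def)
qed

end
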